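(* Let $V$ be a strongly left distributive hypervector space over a hyperfield $F$, and let $U$ and $W$ be two finite dimensional hypersubspaces of $V$. Then $U\# W$ is also a finite dimensional hypersubspace of $V$ and $$\dim(U\# W)=\dim(U)+\dim(W)-\dim(U\cap W).$$
   Context: A hyperoperation on a non-empty set $X$ is a map $X\times X\to P^*(X)$, where $P^*(X)$ is the set of non-empty subsets of $X$. All operations are extended to subsets by unions, e.g. $A\# B=\bigcup_{a\in A,b\in B}a\# b$, $a\ast A=\bigcup_{\alpha\in A}a\ast\alpha$, $B\ast\alpha=\bigcup_{b\in B}b\ast\alpha$; singletons are identified with their elements. A commutative hypergroup $(X,\#)$ is a non-empty set with a commutative hyperoperation such that (1) $x\#(y\# z)=(x\# y)\# z$; (2) there is $0\in X$ such that for every $a\in X$ there is a unique $b\in X$ with $0\in a\# b$ and $0\in b\# a$, and this $b$ is denoted $-a$; (3) $a\in b\# c$ implies $b\in a\#(-c)$. (The zero element is then unique.) A hyperfield $(F,\oplus,\cdot)$ is a commutative hypergroup $(F,\oplus)$ with zero element $0$ together with a single-valued, associative, commutative multiplication $\cdot$ that distributes over $\oplus$ (equality of sets, both sides), with $a\cdot 0=0\cdot a=0$ for all $a$, with an identity $1_F\neq 0$, and such that each $a\ne0$ has $a^{-1}$ with $a\cdot a^{-1}=1_F$. A hypervector space $V$ over $F$ is a commutative hypergroup $(V,\#)$ with zero vector $\theta$, together with a map $\ast:F\times V\to P^*(V)$ such that for all $a,b\in F$, $\alpha,\beta\in V$: (i) $a\ast(\alpha\#\beta)\subseteq a\ast\alpha\#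 a\ast\beta$; (ii) $(a\oplus b)\ast\alpha\subseteq a\ast\alpha\# b\ast\alpha$; (iii) $(a\cdot b)\ast\alpha=a\ast(b\ast\alpha)$; (iv) $1_F\ast\alpha=\{\alpha\}$ and $0\ast\alpha=\{\theta\}$. It is strongly left distributive if equality always holds in (ii). A hypersubspace of $V$ is a subset $W\subseteq V$ that is a hypervector space over $F$ under the operations $\#$ and $\ast$ of $V$. For hypersubspaces $U,W$, $U\# W=\bigcup\{\alpha\#\beta:\alpha\in U,\beta\in W\}$. A finite subset $\{\alpha_1,\dots,\alpha_n\}$ of $V$ is linearly dependent if there are $a_1,\dots,a_n\in F$, not all zero, with $\theta\in a_1\ast\alpha_1\#\cdots\# a_n\ast\alpha_n$. An arbitrary subset is linearly dependent if it contains a finite linearly dependent subset; otherwise it is linearly independent. A vector $\alpha$ is a linear combination of $\alpha_1,\dots,\alpha_n$ if $\alpha\in a_1\ast\alpha_1\#\cdots\# a_n\ast\alpha_n$ for some $a_i\in F$; by convention the only linear combination of the empty family is $\theta$. A subset $S$ of a hypervector space is a basis (Hamel basis) of it if $S$ is linearly independent and every element of the space is a linear combination of finitely many elements of $S$. The space is finite dimensional if it has a finite basis $S$, and its dimension $\dim$ is then the number of elements of $S$. *)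

theory Defs
  imports "HOL-Algebra.Group"
begin

text \<open>Extension of a hyperoperation to subsets. Singletons are written explicitly.\<close>

definition hext :: "('a \<Rightarrow> 'b \<Rightarrow> 'c set) \<Rightarrow> 'a set \<Rightarrow> 'b set \<Rightarrow> 'c set"
  where "hext h A B = (\<Union>a\<in>A. \<Union>b\<in>B. h a b)"


section \<open>Commutative hypergroups\<close>

definition hyperoperation :: "'a set \<Rightarrow> ('a \<Rightarrow> 'a \<Rightarrow> 'a set) \<Rightarrow> bool"
  where "hyperoperation X h \<longleftrightarrow> (\<forall>x\<in>X. \<forall>y\<in>X. h x y \<subseteq> X \<and> h x y \<noteq> {})"

definition hneg :: "'a set \<Rightarrow> ('a \<Rightarrow> 'a \<Rightarrow> 'a set) \<Rightarrow> 'a \<Rightarrow> 'a \<Rightarrow> 'a"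
  where "hneg X h z a = (THE b. b \<in> X \<and> z \<in> h a b \<and> z \<in> h b a)"

definition is_hzero :: "'a set \<Rightarrow> ('a \<Rightarrow> 'a \<Rightarrow> 'a set) \<Rightarrow> 'a \<Rightarrow> bool"
  where "is_hzero X h z \<longleftrightarrow> z \<in> X \<and>
    (\<forall>a\<in>X. \<exists>!b. b \<in> X \<and> z \<in> h a b \<and> z \<in> h b a) \<and>
    (\<forall>a\<in>X. \<forall>b\<in>X. \<forall>c\<in>X. a \<in> h b c \<longrightarrow> b \<in> h a (hneg X h z c))"

definition comm_hypergroup :: "'a set \<Rightarrow> ('a \<Rightarrow> 'a \<Rightarrow> 'a set) \<Rightarrow> bool"
  where "comm_hypergroup X h \<longleftrightarrow>
    X \<noteq> {} \<and> hyperoperation X h \<and>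
    (\<forall>x\<in>X. \<forall>y\<in>X. h x y = h y x) \<and>
    (\<forall>x\<in>X. \<forall>y\<in>X. \<forall>z\<in>X. hext h {x} (h y z) = hext h (h x y) {z}) \<and>
    (\<exists>z. is_hzero X h z)"

text \<open>The zero element is not part of the data: it is determined by the carrier and the
  hyperoperation, and so is a subspace's own zero.\<close>

definition hzero :: "'a set \<Rightarrow> ('a \<Rightarrow> 'a \<Rightarrow> 'a set) \<Rightarrow> 'a"
  where "hzero X h = (THE z. is_hzero X h z)"


section \<open>Hyperfields\<close>

record 'a hyperring = "'a monoid" +
  fadd :: "'a \<Rightarrow> 'a \<Rightarrow> 'a set"  (infixl "\<oplus>\<index>" 65)

definition fzero :: "('a, 'm) hyperring_scheme \<Rightarrow> 'a"  ("\<zero>\<index>")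
  where "fzero F = hzero (carrier F) (fadd F)"

locale hyperfield = comm_monoid F for F :: "('f, 'm) hyperring_scheme" (structure) +
  assumes add_hypergroup: "comm_hypergroup (carrier F) (fadd F)"
    and l_distrib: "\<lbrakk>a \<in> carrier F; b \<in> carrier F; c \<in> carrier F\<rbrakk>
      \<Longrightarrow> (\<lambda>x. a \<otimes> x) ` (b \<oplus> c) = (a \<otimes> b) \<oplus> (a \<otimes> c)"
    and r_distrib: "\<lbrakk>a \<in> carrier F; b \<in> carrier F; c \<in> carrier F\<rbrakk>
      \<Longrightarrow> (\<lambda>x. x \<otimes> a) ` (b \<oplus> c) = (b \<otimes> a) \<oplus> (c \<otimes> a)"
    and mult_zero: "a \<in> carrier F \<Longrightarrow> a \<otimes> \<zero> = \<zero> \<and> \<zero> \<otimes> a = \<zero>"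
    and one_neq_zero: "\<one> \<noteq> \<zero>"
    and inverse_ex: "\<lbrakk>a \<in> carrier F; a \<noteq> \<zero>\<rbrakk> \<Longrightarrow> \<exists>b\<in>carrier F. a \<otimes> b = \<one>"


section \<open>Hypervector spaces\<close>

record ('f, 'v) hypervec = "'v partial_object" +
  vadd :: "'v \<Rightarrow> 'v \<Rightarrow> 'v set"  (infixl "\<boxplus>\<index>" 65)
  smul :: "'f \<Rightarrow> 'v \<Rightarrow> 'v set"  (infixr "\<star>\<index>" 70)

definition vzero :: "('f, 'v, 'n) hypervec_scheme \<Rightarrow> 'v"  ("\<theta>\<index>")
  where "vzero V = hzero (carrier V) (vadd V)"

locale hypervector_space = hyperfield F
  for F :: "('f, 'm) hyperring_scheme" (structure)
    and V :: "('f, 'v, 'n) hypervec_scheme" (structure) +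
  assumes vec_hypergroup: "comm_hypergroup (carrier V) (vadd V)"
    and smul_closed: "\<lbrakk>a \<in> carrier F; \<alpha> \<in> carrier V\<rbrakk>
      \<Longrightarrow> a \<star>\<^bsub>V\<^esub> \<alpha> \<subseteq> carrier V \<and> a \<star>\<^bsub>V\<^esub> \<alpha> \<noteq> {}"
    and smul_vadd: "\<lbrakk>a \<in> carrier F; \<alpha> \<in> carrier V; \<beta> \<in> carrier V\<rbrakk>
      \<Longrightarrow> hext (smul V) {a} (\<alpha> \<boxplus>\<^bsub>V\<^esub> \<beta>) \<subseteq> hext (vadd V) (a \<star>\<^bsub>V\<^esub> \<alpha>) (a \<star>\<^bsub>V\<^esub> \<beta>)"
    and fadd_smul: "\<lbrakk>a \<in> carrier F; b \<in> carrier F; \<alpha> \<in> carrier V\<rbrakk>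
      \<Longrightarrow> hext (smul V) (a \<oplus>\<^bsub>F\<^esub> b) {\<alpha>} \<subseteq> hext (vadd V) (a \<star>\<^bsub>V\<^esub> \<alpha>) (b \<star>\<^bsub>V\<^esub> \<alpha>)"
    and mult_smul: "\<lbrakk>a \<in> carrier F; b \<in> carrier F; \<alpha> \<in> carrier V\<rbrakk>
      \<Longrightarrow> (a \<otimes>\<^bsub>F\<^esub> b) \<star>\<^bsub>V\<^esub> \<alpha> = hext (smul V) {a} (b \<star>\<^bsub>V\<^esub> \<alpha>)"
    and one_smul: "\<alpha> \<in> carrier V \<Longrightarrow> \<one>\<^bsub>F\<^esub> \<star>\<^bsub>V\<^esub> \<alpha> = {\<alpha>}"
    and zero_smul: "\<alpha> \<in> carrier V \<Longrightarrow> \<zero>\<^bsub>F\<^esub> \<star>\<^bsub>V\<^esub> \<alpha> = {\<theta>\<^bsub>V\<^esub>}"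

definition strongly_left_distributive ::
    "('f, 'm) hyperring_scheme \<Rightarrow> ('f, 'v, 'n) hypervec_scheme \<Rightarrow> bool"
  where "strongly_left_distributive F V \<longleftrightarrow>
    (\<forall>a\<in>carrier F. \<forall>b\<in>carrier F. \<forall>\<alpha>\<in>carrier V.
      hext (smul V) (a \<oplus>\<^bsub>F\<^esub> b) {\<alpha>} = hext (vadd V) (a \<star>\<^bsub>V\<^esub> \<alpha>) (b \<star>\<^bsub>V\<^esub> \<alpha>))"

abbreviation restrict_space ::
    "('f, 'v, 'n) hypervec_scheme \<Rightarrow> 'v set \<Rightarrow> ('f, 'v, 'n) hypervec_scheme"
  where "restrict_space V W \<equiv> V\<lparr>carrier := W\<rparr>"

definition hypersubspace ::
    "('f, 'm) hyperring_scheme \<Rightarrow> ('f, 'v, 'n) hypervec_scheme \<Rightarrow> 'v set \<Rightarrow> bool"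
  where "hypersubspace F V W \<longleftrightarrow>
    W \<subseteq> carrier V \<and> hypervector_space F (restrict_space V W)"


section \<open>Linear combinations, bases and dimension\<close>

text \<open>Hypersum of finitely many subsets. The bracketing is immaterial by associativity;
  the first clause is the convention for the empty family.\<close>

fun vsum :: "('f, 'v, 'n) hypervec_scheme \<Rightarrow> 'v set list \<Rightarrow> 'v set"
  where
    "vsum V [] = {\<theta>\<^bsub>V\<^esub>}"
  | "vsum V [A] = A"
  | "vsum V (A # B # As) = hext (vadd V) A (vsum V (B # As))"

definition lincombs :: "('f, 'v, 'n) hypervec_scheme \<Rightarrow> 'f list \<Rightarrow> 'v list \<Rightarrow> 'v set"
  where "lincombs V as vs = vsum V (map2 (smul V) as vs)"

definition is_lincomb ::
    "('f, 'm) hyperring_scheme \<Rightarrow> ('f, 'v, 'n) hypervec_scheme \<Rightarrow> 'v list \<Rightarrow> 'v \<Rightarrow> bool"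
  where "is_lincomb F V vs \<alpha> \<longleftrightarrow>
    (\<exists>as. length as = length vs \<and> set as \<subseteq> carrier F \<and> \<alpha> \<in> lincombs V as vs)"

text \<open>For a finite set, one duplicate-free enumeration suffices: the order is immaterial by
  commutativity.\<close>

definition fin_dependent ::
    "('f, 'm) hyperring_scheme \<Rightarrow> ('f, 'v, 'n) hypervec_scheme \<Rightarrow> 'v set \<Rightarrow> bool"
  where "fin_dependent F V S \<longleftrightarrow>
    (\<exists>vs as. distinct vs \<and> set vs = S \<and> length as = length vs \<and> set as \<subseteq> carrier F \<and>
      (\<exists>a\<in>set as. a \<noteq> \<zero>\<^bsub>F\<^esub>) \<and> \<theta>\<^bsub>V\<^esub> \<in> lincombs V as vs)"

definition lin_dependent ::
    "('f, 'm) hyperring_scheme \<Rightarrow> ('f, 'v, 'n) hypervec_scheme \<Rightarrow> 'v set \<Rightarrow> bool"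
  where "lin_dependent F V S \<longleftrightarrow> (\<exists>T\<subseteq>S. finite T \<and> fin_dependent F V T)"

definition is_basis ::
    "('f, 'm) hyperring_scheme \<Rightarrow> ('f, 'v, 'n) hypervec_scheme \<Rightarrow> 'v set \<Rightarrow> bool"
  where "is_basis F V S \<longleftrightarrow>
    S \<subseteq> carrier V \<and> \<not> lin_dependent F V S \<and>
    (\<forall>\<alpha>\<in>carrier V. \<exists>vs. distinct vs \<and> set vs \<subseteq> S \<and> is_lincomb F V vs \<alpha>)"

definition finite_dimensional ::
    "('f, 'm) hyperring_scheme \<Rightarrow> ('f, 'v, 'n) hypervec_scheme \<Rightarrow> bool"
  where "finite_dimensional F V \<longleftrightarrow> (\<exists>S. finite S \<and> is_basis F V S)"

definition hdim ::
    "('f, 'm) hyperring_scheme \<Rightarrow> ('f, 'v, 'n) hypervec_scheme \<Rightarrow> nat"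
  where "hdim F V = (THE n. \<exists>S. finite S \<and> is_basis F V S \<and> card S = n)"

end

theory Submission
  imports Defs
begin

text \<open>The maps \<open>\<alpha> \<mapsto> a \<star> \<alpha>\<close> with \<open>a \<noteq> \<zero>\<close> are invertible, and reversibility of the hyperaddition
  allows one to solve \<open>\<alpha> \<in> \<beta> # \<gamma>\<close> for \<open>\<beta>\<close>. Hence the span operator has the exchange property,
  and bases behave as in any pregeometry. Strong left distributivity enters only through the
  fact that the multiples of a single vector form a subspace.

  For the dimension formula, a basis \<open>B\<close> of \<open>U \<inter> W\<close> is extended to bases \<open>B \<union> C\<close> of \<open>U\<close> and
  \<open>B \<union> D\<close> of \<open>W\<close>. If some \<open>d \<in> D\<close> lies in \<open>u # s\<close> with \<open>u \<in> U\<close> and \<open>s\<close> in the span of a set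
  \<open>D' \<subseteq> D - {d}\<close>, then \<open>u \<in> d # (-s) \<subseteq> W\<close>, so \<open>u\<close> is in the span of \<open>B\<close>, and \<open>d\<close> depends
  on \<open>B \<union> D'\<close>. Therefore \<open>B \<union> C \<union> D\<close> is independent.\<close>

section \<open>Abstract closure operators with exchange: independence, Steinitz bound,
  extension\<close>

section \<open>Pregeometries\<close>

text \<open>\<open>cl_least\<close> combines two laws: with \<open>cl_extensive\<close> it gives
  monotonicity, and for \<open>A = cl B\<close> it gives idempotence.\<close>

locale pregeometry =
  fixes X :: "'a set" and cl :: "'a set \<Rightarrow> 'a set"
  assumes cl_carrier: "A \<subseteq> X \<Longrightarrow> cl A \<subseteq> X"
    and cl_extensive: "A \<subseteq> X \<Longrightarrow> A \<subseteq> cl A"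
    and cl_least: "\<lbrakk>B \<subseteq> X; A \<subseteq> cl B\<rbrakk> \<Longrightarrow> cl A \<subseteq> cl B"
    and cl_exchange: "\<lbrakk>A \<subseteq> X; x \<in> X; y \<in> cl (insert x A); y \<notin> cl A\<rbrakk> \<Longrightarrow> x \<in> cl (insert y A)"
begin

definition indep :: "'a set \<Rightarrow> bool"
  where "indep A \<longleftrightarrow> (\<forall>x\<in>A. x \<notin> cl (A - {x}))"

lemma cl_mono:
  assumes "A \<subseteq> B" "B \<subseteq> X"
  shows "cl A \<subseteq> cl B"
  using assms cl_extensive[of B] by (intro cl_least) auto

lemma indep_empty: "indep {}"
  by (simp add: indep_def)

lemma indep_subset:
  assumes "indep A" "B \<subseteq> A" "A \<subseteq> X"
  shows "indep B"
  unfolding indep_def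
proof
  fix x assume "x \<in> B"
  moreover have "cl (B - {x}) \<subseteq> cl (A - {x})"
    using assms by (intro cl_mono) auto
  ultimately show "x \<notin> cl (B - {x})"
    using assms by (auto simp: indep_def)
qed

text \<open>If an old \<open>y\<close> came to depend on the others, that dependence would have to
  involve \<open>x\<close>; exchange would then put \<open>x\<close> into
  \<open>cl A\<close>.\<close>

lemma indep_insert:
  assumes "indep A" "A \<subseteq> X" "x \<in> X" "x \<notin> cl A"
  shows "indep (insert x A)"
  unfolding indep_def
proof
  have xA: "x \<notin> A" using assms cl_extensive by blast
  fix y assume y: "y \<in> insert x A"
  show "y \<notin> cl (insert x A - {y})"
  proof (cases "y = x")
    case True
    then show ?thesis using assms xA by simp
  next
    case False
    then have yA: "y \<in> A" using y by simp
    have eq: "insert x A - {y} = insert x (A - {y})" using False by auto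
    show ?thesis
    proof
      assume "y \<in> cl (insert x A - {y})"
      then have "x \<in> cl (insert y (A - {y}))"
        using cl_exchange[of "A - {y}" x y] assms yA unfolding eq indep_def by blast
      then show False using assms yA by (simp add: insert_absorb)
    qed
  qed
qed

text \<open>Steinitz replacement: an element of \<open>A\<close> outside \<open>S\<close> is traded
  for one of \<open>S\<close>, preserving independence and cardinality, until
  \<open>A \<subseteq> S\<close>. The induction measure counts the elements still to be
  traded.\<close>

theorem card_indep_le:
  assumes "finite S" "S \<subseteq> X" "finite A" "indep A" "A \<subseteq> cl S"
  shows "card A \<le> card S"
  using assms(3-5)
proof (induction "card (A - S)" arbitrary: A rule: less_induct)
  case less
  show ?case
  proof (cases "A \<subseteq> S")
    case True
    then show ?thesis using assms(1) by (rule card_mono[rotated])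
  next
    case False
    then obtain x where x: "x \<in> A" "x \<notin> S" by blast
    have AX: "A \<subseteq> X" using less.prems cl_carrier[OF assms(2)] by blast
    have "x \<notin> cl (A - {x})" using x less.prems by (auto simp: indep_def)
    \<comment> \<open>Otherwise \<open>cl (A - {x})\<close> would contain \<open>cl S\<close>, and
      with it \<open>x\<close>.\<close>
    then have "\<not> S \<subseteq> cl (A - {x})"
      using cl_least[of "A - {x}" S] AX x less.prems by blast
    then obtain s where s: "s \<in> S" "s \<notin> cl (A - {x})" by blast
    then have sA: "s \<notin> A - {x}" using cl_extensive[of "A - {x}"] AX by blast
    let ?B = "insert s (A - {x})"
    have "indep (A - {x})" using less.prems(2) AX by (rule_tac indep_subset) auto
    then have "indep ?B" using s AX assms(2) by (intro indep_insert) auto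
    moreover have "card (?B - S) < card (A - S)"
      using x s less.prems by (intro psubset_card_mono) auto
    moreover have "?B \<subseteq> cl S" using s less.prems cl_extensive[OF assms(2)] by auto
    ultimately have "card ?B \<le> card S" using less.prems by (intro less.hyps) auto
    moreover have "card ?B = card A"
      using sA x less.prems card_Suc_Diff1[of A x] by simp
    ultimately show ?thesis by simp
  qed
qed

text \<open>The bound provides an independent set between \<open>A\<close> and \<open>Y\<close> of
  greatest size. A point of \<open>Y\<close> outside its closure could be added, so there is
  none.\<close>

lemma indep_extend:
  assumes "finite A" "indep A" "A \<subseteq> Y" "Y \<subseteq> X"
    and bound: "\<And>B. \<lbrakk>finite B; indep B; B \<subseteq> Y\<rbrakk> \<Longrightarrow> card B \<le> n"
  obtains B where "A \<subseteq> B" "finite B" "indep B" "B \<subseteq> Y" "Y \<subseteq> cl B"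
proof -
  let ?P = "\<lambda>B. A \<subseteq> B \<and> finite B \<and> indep B \<and> B \<subseteq> Y"
  have "?P A" using assms by simp
  moreover have "\<forall>B. ?P B \<longrightarrow> card B < Suc n" using bound by (simp add: less_Suc_eq_le)
  ultimately have "\<exists>B. ?P B \<and> (\<forall>C. ?P C \<longrightarrow> card C \<le> card B)"
    by (rule ex_has_greatest_nat)
  then obtain B where B: "?P B" and max: "\<And>C. ?P C \<Longrightarrow> card C \<le> card B"
    by (elim exE conjE) simp
  have "Y \<subseteq> cl B"
  proof
    fix y assume y: "y \<in> Y"
    show "y \<in> cl B"
    proof (rule ccontr)
      assume n: "y \<notin> cl B"
      then have "y \<notin> B" using B assms(4) cl_extensive[of B] by blast
      moreover have "?P (insert y B)"
        using B n y assms(4) by (auto intro!: indep_insert)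
      ultimately show False using max[of "insert y B"] B by simp
    qed
  qed
  with B that show thesis by blast
qed

end


section \<open>Neutrality, negation and set arithmetic in commutative hypergroups\<close>

section \<open>Commutative hypergroups\<close>

lemma hext_mono: "\<lbrakk>A \<subseteq> A'; B \<subseteq> B'\<rbrakk> \<Longrightarrow> hext h A B \<subseteq> hext h A' B'"
  unfolding hext_def by blast

lemma hext_iff: "x \<in> hext h A B \<longleftrightarrow> (\<exists>a\<in>A. \<exists>b\<in>B. x \<in> h a b)"
  by (simp add: hext_def)

locale commutative_hypergroup =
  fixes X :: "'a set" and h :: "'a \<Rightarrow> 'a \<Rightarrow> 'a set"
  assumes comm_hypergroup: "comm_hypergroup X h"
begin

abbreviation zero where "zero \<equiv> hzero X h"
abbreviation neg where "neg \<equiv> hneg X h zero"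

lemma closed: "\<lbrakk>x \<in> X; y \<in> X\<rbrakk> \<Longrightarrow> h x y \<subseteq> X"
  and nonempty: "\<lbrakk>x \<in> X; y \<in> X\<rbrakk> \<Longrightarrow> h x y \<noteq> {}"
  and comm: "\<lbrakk>x \<in> X; y \<in> X\<rbrakk> \<Longrightarrow> h x y = h y x"
  and assoc: "\<lbrakk>x \<in> X; y \<in> X; z \<in> X\<rbrakk> \<Longrightarrow> hext h {x} (h y z) = hext h (h x y) {z}"
  using comm_hypergroup unfolding comm_hypergroup_def hyperoperation_def by blast+

text \<open>Neutrality is not an axiom but follows from reversibility: \<open>y \<in> h z x\<close>
  gives \<open>z \<in> h y (-x)\<close>, so \<open>x\<close> and \<open>y\<close> are both inverse
  to \<open>-x\<close> and coincide.\<close>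

lemma is_hzero_neutral:
  assumes z: "is_hzero X h z" and x: "x \<in> X"
  shows "h z x = {x}"
proof -
  have zX: "z \<in> X" and ex1: "\<And>a. a \<in> X \<Longrightarrow> \<exists>!b. b \<in> X \<and> z \<in> h a b \<and> z \<in> h b a"
    and rev: "\<And>a b c. \<lbrakk>a \<in> X; b \<in> X; c \<in> X; a \<in> h b c\<rbrakk> \<Longrightarrow> b \<in> h a (hneg X h z c)"
    using z unfolding is_hzero_def by blast+
  let ?n = "hneg X h z x"
  have n: "?n \<in> X" "z \<in> h x ?n" "z \<in> h ?n x"
    using theI'[OF ex1[OF x]] unfolding hneg_def by blast+
  have "y = x" if y: "y \<in> h z x" for y
  proof -
    have yX: "y \<in> X" using y closed[OF zX x] by blast
    have "z \<in> h y ?n" using rev[OF yX zX x y] .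
    then show ?thesis using ex1[OF n(1)] n x yX comm[OF yX n(1)] by blast
  qed
  then show ?thesis using nonempty[OF zX x] by blast
qed

text \<open>Two zeros are neutral for each other. This makes the definite description in
  \<open>hzero\<close> meaningful.\<close>

lemma is_hzero_unique:
  assumes "is_hzero X h y" "is_hzero X h z"
  shows "y = z"
  using assms is_hzero_neutral[of y z] is_hzero_neutral[of z y] comm[of y z]
  by (auto simp: is_hzero_def)

lemma is_hzero_zero: "is_hzero X h zero"
proof -
  have "\<exists>z. is_hzero X h z" using comm_hypergroup by (auto simp: comm_hypergroup_def)
  then have "\<exists>!z. is_hzero X h z" using is_hzero_unique by blast
  then show ?thesis unfolding hzero_def by (rule theI')
qed

lemma zero_closed: "zero \<in> X"
  using is_hzero_zero by (simp add: is_hzero_def)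

lemma zero_add: "x \<in> X \<Longrightarrow> h zero x = {x}"
  by (rule is_hzero_neutral[OF is_hzero_zero])

lemma add_zero: "x \<in> X \<Longrightarrow> h x zero = {x}"
  using zero_add comm zero_closed by metis

lemma neg_ex1: "x \<in> X \<Longrightarrow> \<exists>!b. b \<in> X \<and> zero \<in> h x b \<and> zero \<in> h b x"
  using is_hzero_zero by (simp add: is_hzero_def)

lemma neg_closed: "x \<in> X \<Longrightarrow> neg x \<in> X"
  and neg_add: "x \<in> X \<Longrightarrow> zero \<in> h (neg x) x"
  and add_neg: "x \<in> X \<Longrightarrow> zero \<in> h x (neg x)"
  using theI'[OF neg_ex1] unfolding hneg_def by blast+

lemma neg_unique:
  assumes "x \<in> X" "y \<in> X" "zero \<in> h x y"
  shows "y = neg x"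
  using neg_ex1[OF assms(1)] assms neg_closed add_neg neg_add comm by metis

lemma reverse:
  assumes "a \<in> h b c" "b \<in> X" "c \<in> X"
  shows "b \<in> h a (neg c)"
  using is_hzero_zero assms closed[of b c] by (auto simp: is_hzero_def)

lemma hext_closed: "\<lbrakk>A \<subseteq> X; B \<subseteq> X\<rbrakk> \<Longrightarrow> hext h A B \<subseteq> X"
  using closed unfolding hext_def by blast

lemma hext_comm:
  assumes "A \<subseteq> X" "B \<subseteq> X"
  shows "hext h A B = hext h B A"
proof -
  have "hext h A B = (\<Union>a\<in>A. \<Union>b\<in>B. h b a)"
    unfolding hext_def using assms by (intro SUP_cong refl comm) auto
  also have "\<dots> = hext h B A"
    unfolding hext_def by (rule SUP_commute)
  finally show ?thesis .
qed

lemma hext_assoc: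
  assumes "A \<subseteq> X" "B \<subseteq> X" "C \<subseteq> X"
  shows "hext h A (hext h B C) = hext h (hext h A B) C"
proof -
  have "hext h A (hext h B C) = (\<Union>a\<in>A. \<Union>b\<in>B. \<Union>c\<in>C. hext h {a} (h b c))"
    unfolding hext_def by blast
  also have "\<dots> = (\<Union>a\<in>A. \<Union>b\<in>B. \<Union>c\<in>C. hext h (h a b) {c})"
    using assms by (intro SUP_cong refl assoc) auto
  also have "\<dots> = hext h (hext h A B) C"
    unfolding hext_def by blast
  finally show ?thesis .
qed

lemma hext_interchange:
  assumes "A \<subseteq> X" "B \<subseteq> X" "C \<subseteq> X" "D \<subseteq> X"
  shows "hext h (hext h A B) (hext h C D) = hext h (hext h A C) (hext h B D)"
proof -
  have "hext h (hext h A B) (hext h C D) = hext h A (hext h (hext h B C) D)"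
    using assms by (simp add: hext_assoc hext_closed)
  also have "\<dots> = hext h A (hext h (hext h C B) D)"
    using hext_comm[of B C] assms by simp
  also have "\<dots> = hext h (hext h A C) (hext h B D)"
    using assms by (simp add: hext_assoc hext_closed)
  finally show ?thesis .
qed

lemma hext_zero: "A \<subseteq> X \<Longrightarrow> hext h A {zero} = A"
  using add_zero unfolding hext_def by fastforce

text \<open>Zero and negatives of \<open>T\<close> are definite descriptions over \<open>T\<close>,
  so they have to be compared with those of \<open>X\<close>. Uniqueness of inverses in
  \<open>X\<close> settles the negatives, and uniqueness of the zero in \<open>T\<close> settles the
  zero.\<close>

lemma subhypergroup:
  assumes "T \<subseteq> X" "zero \<in> T" "\<And>x y. \<lbrakk>x \<in> T; y \<in> T\<rbrakk> \<Longrightarrow> h x y \<subseteq> T"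
    and "\<And>x. x \<in> T \<Longrightarrow> neg x \<in> T"
  shows "comm_hypergroup T h" and "hzero T h = zero"
proof -
  have ex1: "\<exists>!b. b \<in> T \<and> zero \<in> h a b \<and> zero \<in> h b a" if "a \<in> T" for a
  proof -
    have "a \<in> X" using that assms(1) by blast
    then show ?thesis
      using that assms(1,4) neg_unique[of a] add_neg[of a] neg_add[of a]
      by (intro ex1I[of _ "neg a"]) auto
  qed
  have neg: "hneg T h zero a = neg a" if "a \<in> T" for a
  proof -
    have "a \<in> X" using that assms(1) by blast
    then show ?thesis
      unfolding hneg_def[of T] using that assms(4) add_neg[of a] neg_add[of a]
      by (intro the1_equality ex1) auto
  qed
  have "b \<in> h a (hneg T h zero c)" if "a \<in> T" "b \<in> T" "c \<in> T" "a \<in> h b c" for a b c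
    unfolding neg[OF that(3)] using that assms(1) by (intro reverse) auto
  then have z: "is_hzero T h zero"
    unfolding is_hzero_def using assms(2) ex1 by blast
  show "comm_hypergroup T h"
    unfolding comm_hypergroup_def hyperoperation_def
  proof (intro conjI ballI)
    show "T \<noteq> {}" using assms(2) by blast
    show "\<exists>z. is_hzero T h z" using z by blast
    fix x y assume xy: "x \<in> T" "y \<in> T"
    then have xyX: "x \<in> X" "y \<in> X" using assms(1) by auto
    show "h x y \<subseteq> T" using xy by (rule assms(3))
    show "h x y \<noteq> {}" using xyX by (rule nonempty)
    show "h x y = h y x" using xyX by (rule comm)
    fix z assume "z \<in> T"
    then show "hext h {x} (h y z) = hext h (h x y) {z}"
      using xyX assms(1) by (intro assoc) auto
  qed
  then interpret T: commutative_hypergroup T h by unfold_locales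
  show "hzero T h = zero" using T.is_hzero_unique z T.is_hzero_zero by blast
qed

end


section \<open>Closure conditions for hypersubspaces\<close>

section \<open>Subspaces and spans\<close>

context hypervector_space
begin

sublocale scal: commutative_hypergroup "carrier F" "fadd F"
  by unfold_locales (rule add_hypergroup)

sublocale vec: commutative_hypergroup "carrier V" "vadd V"
  rewrites "hzero (carrier V) (vadd V) = \<theta>\<^bsub>V\<^esub>"
  by unfold_locales (simp_all add: vec_hypergroup vzero_def)

lemma fzero_closed: "\<zero>\<^bsub>F\<^esub> \<in> carrier F"
  using scal.zero_closed by (simp add: fzero_def)

abbreviation vneg where "vneg \<equiv> hneg (carrier V) (vadd V) \<theta>\<^bsub>V\<^esub>"

definition minus_one where "minus_one = hneg (carrier F) (fadd F) \<zero>\<^bsub>F\<^esub> \<one>\<^bsub>F\<^esub>"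

lemma minus_one_closed: "minus_one \<in> carrier F"
  using scal.neg_closed[of "\<one>\<^bsub>F\<^esub>"] by (simp add: minus_one_def fzero_def)

text \<open>From \<open>\<zero> \<in> \<one> \<oplus> minus_one\<close> one gets
  \<open>\<theta> \<in> v \<boxplus> w\<close> for some \<open>w\<close> in
  \<open>minus_one \<star> v\<close>, and inverses are unique. Hence closure under scalars implies
  closure under negation.\<close>

lemma vneg_smul:
  assumes "v \<in> carrier V"
  shows "vneg v \<in> minus_one \<star>\<^bsub>V\<^esub> v"
proof -
  have "\<zero>\<^bsub>F\<^esub> \<in> \<one>\<^bsub>F\<^esub> \<oplus>\<^bsub>F\<^esub> minus_one"
    using scal.add_neg[of "\<one>\<^bsub>F\<^esub>"] by (simp add: minus_one_def fzero_def)
  then have "\<theta>\<^bsub>V\<^esub> \<in> hext (smul V) (\<one>\<^bsub>F\<^esub> \<oplus>\<^bsub>F\<^esub> minus_one) {v}"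
    using zero_smul[OF assms] by (force simp: hext_iff)
  then have "\<theta>\<^bsub>V\<^esub> \<in> hext (vadd V) (\<one>\<^bsub>F\<^esub> \<star>\<^bsub>V\<^esub> v) (minus_one \<star>\<^bsub>V\<^esub> v)"
    using fadd_smul[OF one_closed minus_one_closed assms] by blast
  then obtain w where "w \<in> minus_one \<star>\<^bsub>V\<^esub> v" "\<theta>\<^bsub>V\<^esub> \<in> v \<boxplus>\<^bsub>V\<^esub> w"
    using one_smul[OF assms] by (auto simp: hext_iff)
  then show ?thesis
    using vec.neg_unique[of v w] smul_closed[OF minus_one_closed assms] assms by auto
qed

text \<open>For \<open>b\<close> the inverse of \<open>a\<close>, the set \<open>b \<star> w\<close>
  is a nonempty part of \<open>b \<star> (a \<star> v) = {v}\<close>.\<close>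

lemma smul_invert:
  assumes "a \<in> carrier F" "a \<noteq> \<zero>\<^bsub>F\<^esub>" "v \<in> carrier V" "w \<in> a \<star>\<^bsub>V\<^esub> v"
  obtains b where "b \<in> carrier F" "v \<in> b \<star>\<^bsub>V\<^esub> w"
proof -
  obtain b where b: "b \<in> carrier F" "a \<otimes>\<^bsub>F\<^esub> b = \<one>\<^bsub>F\<^esub>"
    using inverse_ex assms by blast
  have "hext (smul V) {b} (a \<star>\<^bsub>V\<^esub> v) = {v}"
    using mult_smul[of b a v] b assms one_smul m_comm by simp
  moreover have "b \<star>\<^bsub>V\<^esub> w \<noteq> {}"
    using smul_closed b assms by blast
  ultimately have "v \<in> b \<star>\<^bsub>V\<^esub> w"
    using assms(4) by (fastforce simp: hext_def)
  with b that show thesis by blast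
qed

text \<open>The elementwise subspace criterion. Negatives are covered by the scalar condition,
  through \<open>minus_one\<close>.\<close>

definition linear_subset :: "'v set \<Rightarrow> bool"
  where "linear_subset T \<longleftrightarrow> T \<subseteq> carrier V \<and> \<theta>\<^bsub>V\<^esub> \<in> T \<and>
    (\<forall>x\<in>T. \<forall>y\<in>T. x \<boxplus>\<^bsub>V\<^esub> y \<subseteq> T) \<and> (\<forall>a\<in>carrier F. \<forall>x\<in>T. a \<star>\<^bsub>V\<^esub> x \<subseteq> T)"

lemma linear_subsetI:
  assumes "T \<subseteq> carrier V" "\<theta>\<^bsub>V\<^esub> \<in> T"
    and "\<And>x y. \<lbrakk>x \<in> T; y \<in> T\<rbrakk> \<Longrightarrow> x \<boxplus>\<^bsub>V\<^esub> y \<subseteq> T"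
    and "\<And>a x. \<lbrakk>a \<in> carrier F; x \<in> T\<rbrakk> \<Longrightarrow> a \<star>\<^bsub>V\<^esub> x \<subseteq> T"
  shows "linear_subset T"
  using assms by (simp add: linear_subset_def)

lemma linear_subsetD:
  assumes "linear_subset T"
  shows "T \<subseteq> carrier V" and "\<theta>\<^bsub>V\<^esub> \<in> T"
    and "\<lbrakk>x \<in> T; y \<in> T; z \<in> x \<boxplus>\<^bsub>V\<^esub> y\<rbrakk> \<Longrightarrow> z \<in> T"
    and "\<lbrakk>a \<in> carrier F; x \<in> T; z \<in> a \<star>\<^bsub>V\<^esub> x\<rbrakk> \<Longrightarrow> z \<in> T"
  using assms unfolding linear_subset_def by blast+

lemma linear_subset_vneg: "\<lbrakk>linear_subset T; x \<in> T\<rbrakk> \<Longrightarrow> vneg x \<in> T"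
  using vneg_smul minus_one_closed unfolding linear_subset_def by blast

lemma linear_subset_hext: "\<lbrakk>linear_subset T; A \<subseteq> T; B \<subseteq> T\<rbrakk> \<Longrightarrow> hext (vadd V) A B \<subseteq> T"
  unfolding linear_subset_def hext_def by blast

lemma linear_subset_carrier: "linear_subset (carrier V)"
  unfolding linear_subset_def using vec.zero_closed vec.closed smul_closed by auto

lemma linear_subset_Int: "\<lbrakk>linear_subset T; linear_subset T'\<rbrakk> \<Longrightarrow> linear_subset (T \<inter> T')"
  unfolding linear_subset_def by blast

lemma vzero_restrict:
  assumes "linear_subset T"
  shows "\<theta>\<^bsub>restrict_space V T\<^esub> = \<theta>\<^bsub>V\<^esub>"
  unfolding vzero_def[of "restrict_space V T"] using assms linear_subset_vneg[OF assms]
  by (simp, intro vec.subhypergroup(2)) (auto simp: linear_subset_def)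

text \<open>Given the closure conditions, the laws are inherited from \<open>V\<close> once the zero
  vector of the restricted space is known to be that of \<open>V\<close>.\<close>

lemma hypersubspace_iff: "hypersubspace F V T \<longleftrightarrow> linear_subset T"
proof
  assume T: "linear_subset T"
  then have TV: "T \<subseteq> carrier V" by (simp add: linear_subset_def)
  note zero = vzero_restrict[OF T]
  have "comm_hypergroup T (vadd V)"
    using T linear_subset_vneg[OF T]
    by (intro vec.subhypergroup(1)) (auto simp: linear_subset_def)
  then have "hypervector_space F (restrict_space V T)"
  proof (unfold_locales, goal_cases)
    case 1
    then show ?case by simp
  next
    case (2 a x)
    then show ?case using T TV smul_closed[of a x] by (auto simp: linear_subset_def)
  next
    case (3 a x y)
    then show ?case using TV smul_vadd[of a x y] by auto
  next
    case (4 a b x)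
    then show ?case using TV fadd_smul[of a b x] by auto
  next
    case (5 a b x)
    then show ?case using TV mult_smul[of a b x] by auto
  next
    case (6 x)
    then show ?case using TV one_smul[of x] by auto
  next
    case (7 x)
    then show ?case using TV zero_smul[of x] zero by auto
  qed
  with TV show "hypersubspace F V T" by (simp add: hypersubspace_def)
next
  assume T: "hypersubspace F V T"
  then interpret T: hypervector_space F "restrict_space V T"
    by (simp add: hypersubspace_def)
  have TV: "T \<subseteq> carrier V" using T by (simp add: hypersubspace_def)
  obtain x where x: "x \<in> T" using T.vec.zero_closed by auto
  \<comment> \<open>Multiplying one vector of \<open>T\<close> by the field zero yields the zero
    vector of either space.\<close>
  then have "\<theta>\<^bsub>restrict_space V T\<^esub> = \<theta>\<^bsub>V\<^esub>"
    using T.zero_smul[of x] zero_smul[of x] TV by auto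
  then show "linear_subset T"
    unfolding linear_subset_def using TV T.vec.zero_closed T.vec.closed T.smul_closed by auto
qed

section \<open>Sums of subspaces\<close>

lemma sum_superset:
  assumes T: "linear_subset T" and T': "linear_subset T'"
  shows "T \<subseteq> hext (vadd V) T T'" and "T' \<subseteq> hext (vadd V) T T'"
proof -
  have TV: "T \<subseteq> carrier V" "T' \<subseteq> carrier V" "\<theta>\<^bsub>V\<^esub> \<in> T" "\<theta>\<^bsub>V\<^esub> \<in> T'"
    using T T' by (simp_all add: linear_subset_def)
  have "T = hext (vadd V) T {\<theta>\<^bsub>V\<^esub>}"
    using vec.hext_zero TV by simp
  also have "\<dots> \<subseteq> hext (vadd V) T T'"
    using TV by (intro hext_mono) auto
  finally show "T \<subseteq> hext (vadd V) T T'" .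
  have "T' = hext (vadd V) {\<theta>\<^bsub>V\<^esub>} T'"
    using vec.hext_zero[of T'] vec.hext_comm[of T' "{\<theta>\<^bsub>V\<^esub>}"] TV vec.zero_closed by simp
  also have "\<dots> \<subseteq> hext (vadd V) T T'"
    using TV by (intro hext_mono) auto
  finally show "T' \<subseteq> hext (vadd V) T T'" .
qed

text \<open>Closure under addition is a regrouping of four summands by
  \<open>vec.hext_interchange\<close>; closure under scalars uses the inclusion
  \<open>smul_vadd\<close>.\<close>

lemma linear_subset_sum:
  assumes T: "linear_subset T" and T': "linear_subset T'"
  shows "linear_subset (hext (vadd V) T T')"
proof -
  have TV: "T \<subseteq> carrier V" "T' \<subseteq> carrier V"
    using T T' by (simp_all add: linear_subset_def)
  have add: "hext (vadd V) (hext (vadd V) T T') (hext (vadd V) T T') \<subseteq> hext (vadd V) T T'"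
    unfolding vec.hext_interchange[OF TV TV] using T T'
    by (intro hext_mono linear_subset_hext) auto
  have "a \<star>\<^bsub>V\<^esub> z \<subseteq> hext (vadd V) T T'"
    if a: "a \<in> carrier F" and z: "z \<in> hext (vadd V) T T'" for a z
  proof -
    obtain x y where xy: "x \<in> T" "y \<in> T'" "z \<in> x \<boxplus>\<^bsub>V\<^esub> y"
      using z unfolding hext_iff by blast
    then have "a \<star>\<^bsub>V\<^esub> z \<subseteq> hext (smul V) {a} (x \<boxplus>\<^bsub>V\<^esub> y)"
      by (auto simp: hext_iff)
    also have "\<dots> \<subseteq> hext (vadd V) (a \<star>\<^bsub>V\<^esub> x) (a \<star>\<^bsub>V\<^esub> y)"
      using smul_vadd[OF a, of x y] xy TV by blast
    also have "\<dots> \<subseteq> hext (vadd V) T T'"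
      using T T' a xy by (intro hext_mono) (auto simp: linear_subset_def)
    finally show ?thesis .
  qed
  moreover have "\<theta>\<^bsub>V\<^esub> \<in> hext (vadd V) T T'"
    using sum_superset(1)[OF T T'] linear_subsetD(2)[OF T] by blast
  moreover have "x \<boxplus>\<^bsub>V\<^esub> y \<subseteq> hext (vadd V) T T'"
    if "x \<in> hext (vadd V) T T'" "y \<in> hext (vadd V) T T'" for x y
  proof -
    have "x \<boxplus>\<^bsub>V\<^esub> y = hext (vadd V) {x} {y}" by (simp add: hext_def)
    also have "\<dots> \<subseteq> hext (vadd V) (hext (vadd V) T T') (hext (vadd V) T T')"
      using that by (intro hext_mono) auto
    finally show ?thesis using add by blast
  qed
  ultimately show ?thesis
    using vec.hext_closed[OF TV] by (intro linear_subsetI)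
qed

text \<open>If \<open>A\<close> is not contained in \<open>carrier V\<close>, the family is empty
  and the intersection is the whole type; hence the carrier assumptions in the lemmas below.\<close>

definition span :: "'v set \<Rightarrow> 'v set"
  where "span A = \<Inter>{T. linear_subset T \<and> A \<subseteq> T}"

lemma span_least: "\<lbrakk>linear_subset T; A \<subseteq> T\<rbrakk> \<Longrightarrow> span A \<subseteq> T"
  unfolding span_def by blast

lemma span_superset: "A \<subseteq> span A"
  unfolding span_def by blast

lemma linear_subset_span:
  assumes "A \<subseteq> carrier V"
  shows "linear_subset (span A)"
proof (rule linear_subsetI)
  show "span A \<subseteq> carrier V" using assms by (intro span_least linear_subset_carrier)
  show "\<theta>\<^bsub>V\<^esub> \<in> span A" using linear_subsetD(2) by (simp add: span_def)
  show "x \<boxplus>\<^bsub>V\<^esub> y \<subseteq> span A" if "x \<in> span A" "y \<in> span A" for x y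
    using that linear_subsetD(3) unfolding span_def by blast
  show "a \<star>\<^bsub>V\<^esub> x \<subseteq> span A" if "a \<in> carrier F" "x \<in> span A" for a x
    using that linear_subsetD(4) unfolding span_def by blast
qed

lemma span_mono: "A \<subseteq> B \<Longrightarrow> span A \<subseteq> span B"
  unfolding span_def by blast

lemma span_Un:
  assumes "A \<subseteq> carrier V" "B \<subseteq> carrier V"
  shows "span (A \<union> B) = hext (vadd V) (span A) (span B)"
proof
  have lin: "linear_subset (span A)" "linear_subset (span B)" "linear_subset (span (A \<union> B))"
    using assms by (simp_all add: linear_subset_span)
  show "span (A \<union> B) \<subseteq> hext (vadd V) (span A) (span B)"
    using lin sum_superset[OF lin(1,2)] span_superset[of A] span_superset[of B]
    by (intro span_least linear_subset_sum) auto
  show "hext (vadd V) (span A) (span B) \<subseteq> span (A \<union> B)"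
    using lin by (intro linear_subset_hext span_mono) auto
qed

lemma span_empty: "span {} = {\<theta>\<^bsub>V\<^esub>}"
proof
  have "a \<star>\<^bsub>V\<^esub> \<theta>\<^bsub>V\<^esub> \<subseteq> {\<theta>\<^bsub>V\<^esub>}" if a: "a \<in> carrier F" for a
  proof -
    \<comment> \<open>Write \<open>\<theta>\<close> as a zero multiple of itself and use
      \<open>a \<otimes> \<zero> = \<zero>\<close>.\<close>
    have "hext (smul V) {a} {\<theta>\<^bsub>V\<^esub>} = {\<theta>\<^bsub>V\<^esub>}"
      using mult_smul[OF a fzero_closed vec.zero_closed] mult_zero[OF a]
        zero_smul[OF vec.zero_closed] by simp
    then show ?thesis by (simp add: hext_def)
  qed
  then show "span {} \<subseteq> {\<theta>\<^bsub>V\<^esub>}"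
    using vec.zero_closed vec.zero_add[OF vec.zero_closed]
    by (intro span_least) (auto simp: linear_subset_def)
  show "{\<theta>\<^bsub>V\<^esub>} \<subseteq> span {}"
    using linear_subset_span[of "{}"] by (simp add: linear_subset_def)
qed

end


section \<open>The span as a pregeometry\<close>

section \<open>The exchange property\<close>

locale sld_hypervector_space = hypervector_space F V
  for F :: "('f, 'm) hyperring_scheme" (structure)
    and V :: "('f, 'v, 'n) hypervec_scheme" (structure) +
  assumes sld: "strongly_left_distributive F V"
begin

lemma span_singleton:
  assumes v: "v \<in> carrier V"
  shows "span {v} = (\<Union>a\<in>carrier F. a \<star>\<^bsub>V\<^esub> v)" (is "_ = ?R")
proof
  show "?R \<subseteq> span {v}"
    using linear_subset_span[of "{v}"] span_superset[of "{v}"] v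
    unfolding linear_subset_def by blast
  have "x \<boxplus>\<^bsub>V\<^esub> y \<subseteq> ?R" if x: "x \<in> ?R" and y: "y \<in> ?R" for x y
  proof -
    obtain a b where ab: "a \<in> carrier F" "b \<in> carrier F" "x \<in> a \<star>\<^bsub>V\<^esub> v" "y \<in> b \<star>\<^bsub>V\<^esub> v"
      using x y by blast
    then have "x \<boxplus>\<^bsub>V\<^esub> y \<subseteq> hext (vadd V) (a \<star>\<^bsub>V\<^esub> v) (b \<star>\<^bsub>V\<^esub> v)"
      by (force simp: hext_def)
    \<comment> \<open>The axiom \<open>fadd_smul\<close> gives only the opposite inclusion;
      \<open>sld\<close> makes it an equality.\<close>
    also have "\<dots> = hext (smul V) (a \<oplus>\<^bsub>F\<^esub> b) {v}"
      using sld v ab by (simp add: strongly_left_distributive_def)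
    also have "\<dots> \<subseteq> ?R"
      using scal.closed[OF ab(1,2)] unfolding hext_def by blast
    finally show ?thesis .
  qed
  moreover have "b \<star>\<^bsub>V\<^esub> x \<subseteq> ?R" if x: "x \<in> ?R" and b: "b \<in> carrier F" for x b
  proof -
    obtain a where a: "a \<in> carrier F" "x \<in> a \<star>\<^bsub>V\<^esub> v" using x by blast
    then have "b \<star>\<^bsub>V\<^esub> x \<subseteq> (b \<otimes>\<^bsub>F\<^esub> a) \<star>\<^bsub>V\<^esub> v"
      unfolding mult_smul[OF b a(1) v] by (auto simp: hext_iff)
    then show ?thesis using a b by blast
  qed
  moreover have "?R \<subseteq> carrier V" using smul_closed v by blast
  moreover have "\<theta>\<^bsub>V\<^esub> \<in> ?R" using zero_smul[OF v] fzero_closed by blast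
  ultimately have "linear_subset ?R" by (intro linear_subsetI)
  moreover have "v \<in> ?R" using one_smul[OF v] one_closed by blast
  ultimately show "span {v} \<subseteq> ?R" by (intro span_least) auto
qed

lemma span_insert:
  assumes "v \<in> carrier V" "A \<subseteq> carrier V"
  shows "span (insert v A) = (\<Union>a\<in>carrier F. hext (vadd V) (a \<star>\<^bsub>V\<^esub> v) (span A))"
  using span_Un[of "{v}" A] assms span_singleton[OF assms(1)] by (auto simp: hext_def)

lemma mem_span_of_smul:
  assumes "a \<in> carrier F" "a \<noteq> \<zero>\<^bsub>F\<^esub>" "v \<in> carrier V" "w \<in> a \<star>\<^bsub>V\<^esub> v"
    and "w \<in> span A" "A \<subseteq> carrier V"
  shows "v \<in> span A"
proof -
  obtain b where "b \<in> carrier F" "v \<in> b \<star>\<^bsub>V\<^esub> w" using smul_invert assms by blast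
  then show ?thesis using linear_subset_span assms unfolding linear_subset_def by blast
qed

text \<open>Reversibility acts as subtraction: \<open>p \<in> y \<boxplus> vneg s\<close>, and both
  terms lie in \<open>T\<close>.\<close>

lemma mem_linear_subset_reverse:
  assumes "linear_subset T" "y \<in> p \<boxplus>\<^bsub>V\<^esub> s" "p \<in> carrier V" "y \<in> T" "s \<in> T"
  shows "p \<in> T"
proof -
  have "s \<in> carrier V" using assms by (auto simp: linear_subset_def)
  then have "p \<in> y \<boxplus>\<^bsub>V\<^esub> vneg s" using vec.reverse assms by blast
  then show ?thesis
    using assms linear_subset_vneg[OF assms(1), of s] linear_subsetD(3)[OF assms(1)] by blast
qed

text \<open>For exchange, decompose \<open>y \<in> p \<boxplus> s\<close> with
  \<open>p \<in> a \<star> x\<close> and \<open>s \<in> span A\<close>; then recover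
  \<open>p\<close> from \<open>y\<close> and \<open>s\<close>, and \<open>x\<close> from
  \<open>p\<close> by inverting \<open>a\<close>.\<close>

sublocale pregeometry "carrier V" span
proof
  fix A B :: "'v set" and x y :: 'v
  assume A: "A \<subseteq> carrier V"
  show "span A \<subseteq> carrier V" using A by (intro span_least linear_subset_carrier)
  show "A \<subseteq> span A" by (rule span_superset)
  assume x: "x \<in> carrier V" and y: "y \<in> span (insert x A)" "y \<notin> span A"
  obtain a p s where a: "a \<in> carrier F" and p: "p \<in> a \<star>\<^bsub>V\<^esub> x" and s: "s \<in> span A"
    and yps: "y \<in> p \<boxplus>\<^bsub>V\<^esub> s"
    using y x A by (auto simp: span_insert hext_iff)
  have pV: "p \<in> carrier V" using smul_closed a x p by blast
  have sV: "s \<in> carrier V" using s linear_subset_span[OF A] by (auto simp: linear_subset_def)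
  \<comment> \<open>For \<open>a\<close> zero, \<open>p\<close> would be \<open>\<theta>\<close> and
    \<open>y\<close> would equal \<open>s\<close>, which lies in \<open>span A\<close>.\<close>
  have "a \<noteq> \<zero>\<^bsub>F\<^esub>"
    using p zero_smul[OF x] vec.zero_add[OF sV] yps y s by auto
  moreover have yA: "insert y A \<subseteq> carrier V" using vec.closed[OF pV sV] yps A by auto
  moreover have "p \<in> span (insert y A)"
    using yps pV s span_mono[of A "insert y A"] span_superset[of "insert y A"]
    by (intro mem_linear_subset_reverse[OF linear_subset_span[OF yA], of y p s]) auto
  ultimately show "x \<in> span (insert y A)"
    using mem_span_of_smul a x p by blast
next
  fix A B :: "'v set"
  assume "B \<subseteq> carrier V" "A \<subseteq> span B"
  then show "span A \<subseteq> span B" by (intro span_least linear_subset_span)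
qed


section \<open>Linear combinations and dependence expressed through spans\<close>

section \<open>Linear combinations\<close>

text \<open>Merges the one-element clause of \<open>vsum\<close> with the recursive one.
  \<open>\<theta>\<close> is neutral for subsets of the carrier, hence the assumption.\<close>

lemma vsum_Cons:
  assumes "A \<subseteq> carrier V"
  shows "vsum V (A # As) = hext (vadd V) A (vsum V As)"
  using assms by (cases As) (simp_all add: vec.hext_zero)

lemma lincombs_Cons:
  assumes "a \<in> carrier F" "v \<in> carrier V"
  shows "lincombs V (a # as) (v # vs) = hext (vadd V) (a \<star>\<^bsub>V\<^esub> v) (lincombs V as vs)"
  unfolding lincombs_def using smul_closed assms by (simp add: vsum_Cons del: vsum.simps)

text \<open>Peeling off the head of the list matches \<open>span_insert\<close>. Repetitions in
  \<open>vs\<close> are harmless because \<open>span_insert\<close> also covers a vector already in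
  the set.\<close>

lemma is_lincomb_iff:
  assumes "set vs \<subseteq> carrier V"
  shows "is_lincomb F V vs x \<longleftrightarrow> x \<in> span (set vs)"
  using assms
proof (induction vs arbitrary: x)
  case Nil
  then show ?case by (simp add: is_lincomb_def lincombs_def span_empty)
next
  case (Cons v vs)
  then have v: "v \<in> carrier V" and vs: "set vs \<subseteq> carrier V" by auto
  have IH: "is_lincomb F V vs y \<longleftrightarrow> y \<in> span (set vs)" for y
    using Cons.IH vs .
  show ?case
  proof
    assume "is_lincomb F V (v # vs) x"
    then obtain cs where cs: "length cs = Suc (length vs)" "set cs \<subseteq> carrier F"
      "x \<in> lincombs V cs (v # vs)"
      by (auto simp: is_lincomb_def)
    then obtain a as where [simp]: "cs = a # as" by (cases cs) auto
    then obtain p y where py: "p \<in> a \<star>\<^bsub>V\<^esub> v" "y \<in> lincombs V as vs" "x \<in> p \<boxplus>\<^bsub>V\<^esub> y"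
      using cs v unfolding \<open>cs = a # as\<close> by (auto simp: lincombs_Cons hext_iff)
    then have "y \<in> span (set vs)" using cs IH by (auto simp: is_lincomb_def)
    then show "x \<in> span (set (v # vs))"
      using py cs by (auto simp: span_insert[OF v vs] hext_iff)
  next
    assume "x \<in> span (set (v # vs))"
    then obtain a y where a: "a \<in> carrier F" "x \<in> hext (vadd V) (a \<star>\<^bsub>V\<^esub> v) {y}"
      and "y \<in> span (set vs)"
      by (auto simp: span_insert[OF v vs] hext_iff)
    then obtain as where as: "length as = length vs" "set as \<subseteq> carrier F" "y \<in> lincombs V as vs"
      using IH by (auto simp: is_lincomb_def)
    then have "hext (vadd V) (a \<star>\<^bsub>V\<^esub> v) {y} \<subseteq> lincombs V (a # as) (v # vs)"
      unfolding lincombs_Cons[OF a(1) v] by (intro hext_mono) auto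
    then have "x \<in> lincombs V (a # as) (v # vs)" using a(2) by blast
    then show "is_lincomb F V (v # vs) x"
      unfolding is_lincomb_def using a as by (intro exI[of _ "a # as"]) simp
  qed
qed

text \<open>A combination is solved for a vector with nonzero coefficient. The case of interest is
  \<open>x = \<theta>\<close>; an arbitrary \<open>x\<close> is carried because the tail of the
  combination has a value of its own.\<close>

lemma coefficient_nonzero_mem_span:
  assumes "length as = length vs" "set as \<subseteq> carrier F" "set vs \<subseteq> carrier V" "distinct vs"
    and "i < length vs" "as ! i \<noteq> \<zero>\<^bsub>F\<^esub>" "x \<in> lincombs V as vs"
  shows "vs ! i \<in> span (insert x (set vs - {vs ! i}))"
  using assms
proof (induction as vs arbitrary: i x rule: list_induct2)
  case Nil
  then show ?case by simp
next
  case (Cons a as v vs)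
  have a: "a \<in> carrier F" and v: "v \<in> carrier V" and vs: "set vs \<subseteq> carrier V"
    using Cons.prems by auto
  obtain p y where p: "p \<in> a \<star>\<^bsub>V\<^esub> v" and y: "y \<in> lincombs V as vs" and x: "x \<in> p \<boxplus>\<^bsub>V\<^esub> y"
    using Cons.prems a v by (auto simp: lincombs_Cons hext_iff)
  have pV: "p \<in> carrier V" using smul_closed a v p by blast
  have "is_lincomb F V vs y" using Cons y by (auto simp: is_lincomb_def)
  then have ysp: "y \<in> span (set vs)" using is_lincomb_iff vs by blast
  then have yV: "y \<in> carrier V" using cl_carrier[OF vs] by blast
  have xV: "x \<in> carrier V" using vec.closed[OF pV yV] x by blast
  show ?case
  proof (cases i)
    case 0
    have sub: "insert x (set vs) \<subseteq> carrier V" using xV vs by simp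
    have "p \<in> span (insert x (set vs))"
      using x pV ysp span_mono[of "set vs" "insert x (set vs)"] span_superset[of "insert x (set vs)"]
      by (intro mem_linear_subset_reverse[OF linear_subset_span[OF sub], of x p y]) auto
    then have "v \<in> span (insert x (set vs))"
      using mem_span_of_smul[OF a _ v p _ sub] Cons.prems 0 by simp
    moreover have "set (v # vs) - {v} = set vs" using Cons.prems by auto
    ultimately show ?thesis using 0 by simp
  next
    case (Suc j)
    let ?w = "vs ! j"
    let ?B = "insert x (set (v # vs) - {?w})"
    have B: "?B \<subseteq> carrier V" using xV v vs by auto
    have w: "?w \<in> set vs" using Cons.prems Suc by simp
    \<comment> \<open>The coefficient lies in the tail, whose value is \<open>y\<close>. It remains
      to place \<open>y\<close> in \<open>span ?B\<close>, by subtracting \<open>p\<close> from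
      \<open>x\<close>.\<close>
    have IH: "?w \<in> span (insert y (set vs - {?w}))"
      using Cons y Suc by auto
    \<comment> \<open>Distinctness keeps the head \<open>v\<close> in \<open>?B\<close>, so
      \<open>p\<close> is available there.\<close>
    have "v \<noteq> ?w" using Cons.prems w by auto
    then have "v \<in> span ?B" using span_superset[of ?B] by auto
    then have "p \<in> span ?B"
      using p a linear_subsetD(4)[OF linear_subset_span[OF B]] by blast
    moreover have "x \<in> y \<boxplus>\<^bsub>V\<^esub> p" using x vec.comm pV yV by simp
    ultimately have "y \<in> span ?B"
      using yV span_superset[of ?B]
      by (intro mem_linear_subset_reverse[OF linear_subset_span[OF B], of x y p]) auto
    then have "span (insert y (set vs - {?w})) \<subseteq> span ?B"
      using B span_superset[of ?B] by (intro cl_least) auto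
    then show ?thesis using IH Suc by auto
  qed
qed

text \<open>A vanishing combination is solved for a vector with nonzero coefficient; conversely, a
  vector in the span of the others receives the coefficient \<open>minus_one\<close>.\<close>

lemma lin_dependent_iff:
  assumes "finite S" "S \<subseteq> carrier V"
  shows "lin_dependent F V S \<longleftrightarrow> \<not> indep S"
proof
  assume "lin_dependent F V S"
  then obtain T vs as where T: "T \<subseteq> S" "distinct vs" "set vs = T" "length as = length vs"
    "set as \<subseteq> carrier F" "\<exists>a\<in>set as. a \<noteq> \<zero>\<^bsub>F\<^esub>" "\<theta>\<^bsub>V\<^esub> \<in> lincombs V as vs"
    unfolding lin_dependent_def fin_dependent_def by blast
  then obtain i where i: "i < length vs" "as ! i \<noteq> \<zero>\<^bsub>F\<^esub>" by (metis in_set_conv_nth)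
  let ?w = "vs ! i"
  have w: "?w \<in> T" using T i by auto
  have TV: "T - {?w} \<subseteq> carrier V" using T assms by auto
  have "?w \<in> span (insert \<theta>\<^bsub>V\<^esub> (T - {?w}))"
    using coefficient_nonzero_mem_span[of as vs i] T i assms by auto
  also have "\<dots> \<subseteq> span (T - {?w})"
    using cl_least[OF TV, of "insert \<theta>\<^bsub>V\<^esub> (T - {?w})"] linear_subset_span[OF TV]
      span_superset[of "T - {?w}"]
    by (simp add: linear_subset_def)
  also have "\<dots> \<subseteq> span (S - {?w})" using T by (intro span_mono) auto
  finally show "\<not> indep S" using w T by (auto simp: indep_def)
next
  assume "\<not> indep S"
  then obtain v where v: "v \<in> S" "v \<in> span (S - {v})" by (auto simp: indep_def)
  obtain vs where vs: "set vs = S - {v}" "distinct vs"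
    using finite_distinct_list[of "S - {v}"] assms by auto
  have vV: "v \<in> carrier V" using v assms by auto
  have "is_lincomb F V vs v" using v vs assms is_lincomb_iff[of vs v] by auto
  then obtain as where as: "length as = length vs" "set as \<subseteq> carrier F" "v \<in> lincombs V as vs"
    by (auto simp: is_lincomb_def)
  have "\<theta>\<^bsub>V\<^esub> \<in> lincombs V (minus_one # as) (v # vs)"
    using vneg_smul[OF vV] vec.neg_add[OF vV] as
    by (auto simp: lincombs_Cons minus_one_closed vV hext_iff)
  \<comment> \<open>Otherwise
    \<open>\<zero> \<in> \<one> \<oplus> \<zero> = {\<one>}\<close>.\<close>
  moreover have "minus_one \<noteq> \<zero>\<^bsub>F\<^esub>"
    using scal.add_neg[of "\<one>\<^bsub>F\<^esub>"] scal.add_zero[of "\<one>\<^bsub>F\<^esub>"] one_neq_zero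
    by (auto simp: minus_one_def fzero_def)
  moreover have "set (v # vs) = S" using v vs by auto
  ultimately have "fin_dependent F V S"
    unfolding fin_dependent_def using vs as minus_one_closed
    by (intro exI[of _ "v # vs"] exI[of _ "minus_one # as"]) auto
  then show "lin_dependent F V S" unfolding lin_dependent_def using assms by blast
qed


section \<open>Bases of subspaces as independent spanning sets in the ambient space\<close>

section \<open>Bases and dimension of subspaces\<close>

text \<open>The carrier enters \<open>vsum\<close> only through the zero vector of the empty
  sum.\<close>

lemma lincombs_restrict:
  assumes "linear_subset T"
  shows "lincombs (restrict_space V T) = lincombs V"
proof -
  have "vsum (restrict_space V T) As = vsum V As" for As
    by (induction As rule: induct_list012) (simp_all add: vzero_restrict[OF assms])
  then show ?thesis by (simp add: lincombs_def fun_eq_iff)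
qed

lemma is_basis_restrict_iff:
  assumes T: "linear_subset T" and S: "finite S"
  shows "is_basis F (restrict_space V T) S \<longleftrightarrow> S \<subseteq> T \<and> indep S \<and> T \<subseteq> span S"
proof (cases "S \<subseteq> T")
  case True
  then have SV: "S \<subseteq> carrier V" using T by (auto simp: linear_subset_def)
  have "lin_dependent F (restrict_space V T) S \<longleftrightarrow> lin_dependent F V S"
    unfolding lin_dependent_def fin_dependent_def
    by (simp add: lincombs_restrict[OF T] vzero_restrict[OF T])
  moreover have "(\<exists>vs. distinct vs \<and> set vs \<subseteq> S \<and> is_lincomb F (restrict_space V T) vs x)
      \<longleftrightarrow> x \<in> span S" (is "?L \<longleftrightarrow> _") for x
  proof
    assume ?L
    then obtain vs where vs: "set vs \<subseteq> S" "is_lincomb F V vs x"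
      using lincombs_restrict[OF T] by (auto simp: is_lincomb_def)
    then have "x \<in> span (set vs)" using is_lincomb_iff[of vs x] SV by auto
    then show "x \<in> span S" using span_mono[OF vs(1)] by blast
  next
    assume x: "x \<in> span S"
    \<comment> \<open>As \<open>S\<close> is finite, one enumeration of all of it serves every
      \<open>x\<close>.\<close>
    obtain vs where vs: "set vs = S" "distinct vs" using finite_distinct_list[OF S] by blast
    then have "is_lincomb F V vs x" using is_lincomb_iff SV x by auto
    then show ?L using vs lincombs_restrict[OF T] by (auto simp: is_lincomb_def)
  qed
  ultimately show ?thesis
    using True lin_dependent_iff[OF S SV] by (auto simp: is_basis_def)
qed (auto simp: is_basis_def)

text \<open>Applying \<open>card_indep_le\<close> in both directions shows that finite bases have
  equal size, so the description in \<open>hdim\<close> is determined.\<close>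

lemma basis_dim:
  assumes T: "linear_subset T" and S: "finite S" "S \<subseteq> T" "indep S" "T \<subseteq> span S"
  shows "finite_dimensional F (restrict_space V T)"
    and "hdim F (restrict_space V T) = card S"
proof -
  have TV: "T \<subseteq> carrier V" using T by (simp add: linear_subset_def)
  show "finite_dimensional F (restrict_space V T)"
    unfolding finite_dimensional_def using is_basis_restrict_iff[OF T] S by blast
  have "card S' = card S" if "finite S'" "is_basis F (restrict_space V T) S'" for S'
  proof -
    have S': "S' \<subseteq> T" "indep S'" "T \<subseteq> span S'" using that is_basis_restrict_iff[OF T] by auto
    show ?thesis
      using card_indep_le[of S S'] card_indep_le[of S' S] S S' that TV by (intro antisym) auto
  qed
  then show "hdim F (restrict_space V T) = card S"
    unfolding hdim_def using is_basis_restrict_iff[OF T] S by (intro the_equality) blast+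
qed

lemma finite_dimensionalE:
  assumes "linear_subset T" "finite_dimensional F (restrict_space V T)"
  obtains S where "finite S" "S \<subseteq> T" "indep S" "T \<subseteq> span S"
  using assms is_basis_restrict_iff unfolding finite_dimensional_def by blast

section \<open>The dimension formula\<close>

lemma indep_Un:
  assumes U: "linear_subset U" and W: "linear_subset W"
    and B: "U \<inter> W \<subseteq> span B" and BC: "B \<union> C \<subseteq> U" "indep (B \<union> C)"
    and BD: "B \<union> D \<subseteq> W" "indep (B \<union> D)" "B \<inter> D = {}" and D: "finite D"
  shows "indep (B \<union> C \<union> D) \<and> C \<inter> D = {}"
  using D BD
\<comment> \<open>Adding the vectors of \<open>D\<close> one at a time reduces the claim, by
  \<open>indep_insert\<close>, to the new \<open>d\<close> lying outside the span of the
  rest.\<close>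
proof (induction D)
  case empty
  then show ?case using BC by simp
next
  case (insert d D)
  have UV: "U \<subseteq> carrier V" and WV: "W \<subseteq> carrier V"
    using U W by (simp_all add: linear_subset_def)
  have sub: "B \<union> C \<subseteq> carrier V" "B \<union> D \<subseteq> carrier V" "d \<in> carrier V" "d \<in> W"
    using BC insert UV WV by auto
  have "indep (B \<union> D)"
    using insert.prems WV by (intro indep_subset[of "B \<union> insert d D" "B \<union> D"]) auto
  then have IH: "indep (B \<union> C \<union> D)" "C \<inter> D = {}" using insert by auto
  have "B \<union> insert d D - {d} = B \<union> D" using insert by auto
  then have dBD: "d \<notin> span (B \<union> D)" using insert.prems by (auto simp: indep_def)
  have dBCD: "d \<notin> span (B \<union> C \<union> D)"
  proof
    assume "d \<in> span (B \<union> C \<union> D)"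
    then obtain u s where us: "u \<in> span (B \<union> C)" "s \<in> span D" "d \<in> u \<boxplus>\<^bsub>V\<^esub> s"
      using sub by (auto simp: span_Un[of "B \<union> C" D] hext_iff)
    have "u \<in> U" using us span_least[OF U BC(1)] by blast
    moreover have "s \<in> W" using us span_least[OF W, of D] insert.prems by blast
    ultimately have "u \<in> W" using mem_linear_subset_reverse[OF W us(3)] sub UV by blast
    then have "u \<in> span (B \<union> D)" using \<open>u \<in> U\<close> B span_mono[of B "B \<union> D"] by blast
    moreover have "s \<in> span (B \<union> D)" using us span_mono[of D "B \<union> D"] by blast
    ultimately show False
      using us(3) dBD linear_subset_span[OF sub(2)] by (auto simp: linear_subset_def)
  qed
  have "B \<union> C \<union> insert d D = insert d (B \<union> C \<union> D)" by simp
  moreover have "d \<notin> C" using dBCD span_superset[of "B \<union> C \<union> D"] by blast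
  ultimately show ?case using IH dBCD sub by (auto intro!: indep_insert)
qed

text \<open>The formula is stated additively to avoid truncated subtraction of natural
  numbers.\<close>

theorem hdim_sum:
  assumes U: "linear_subset U" and fU: "finite_dimensional F (restrict_space V U)"
    and W: "linear_subset W" and fW: "finite_dimensional F (restrict_space V W)"
  shows "finite_dimensional F (restrict_space V (hext (vadd V) U W))"
    and "finite_dimensional F (restrict_space V (U \<inter> W))"
    and "hdim F (restrict_space V (hext (vadd V) U W)) + hdim F (restrict_space V (U \<inter> W))
      = hdim F (restrict_space V U) + hdim F (restrict_space V W)"
proof -
  have UV: "U \<subseteq> carrier V" and WV: "W \<subseteq> carrier V"
    using U W by (simp_all add: linear_subset_def)
  obtain S where S: "finite S" "S \<subseteq> U" "indep S" "U \<subseteq> span S"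
    using finite_dimensionalE[OF U fU] .
  obtain S' where S': "finite S'" "S' \<subseteq> W" "indep S'" "W \<subseteq> span S'"
    using finite_dimensionalE[OF W fW] .
  have boundU: "card A \<le> card S" if "finite A" "indep A" "A \<subseteq> U" for A
    using that S UV by (intro card_indep_le) auto
  have boundW: "card A \<le> card S'" if "finite A" "indep A" "A \<subseteq> W" for A
    using that S' WV by (intro card_indep_le) auto
  \<comment> \<open>Independent subsets of the intersection also lie in \<open>U\<close>, so
    \<open>card S\<close> bounds them and the empty set extends to a basis.\<close>
  obtain B where B: "finite B" "indep B" "B \<subseteq> U \<inter> W" "U \<inter> W \<subseteq> span B"
    using indep_extend[of "{}" "U \<inter> W" "card S"] indep_empty boundU UV by auto
  obtain BC where BC: "B \<subseteq> BC" "finite BC" "indep BC" "BC \<subseteq> U" "U \<subseteq> span BC"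
    using indep_extend[of B U "card S"] B boundU UV by auto
  obtain BD where BD: "B \<subseteq> BD" "finite BD" "indep BD" "BD \<subseteq> W" "W \<subseteq> span BD"
    using indep_extend[of B W "card S'"] B boundW WV by auto
  define C where "C = BC - B"
  define D where "D = BD - B"
  have eq: "BC = B \<union> C" "BD = B \<union> D" "B \<inter> C = {}" "B \<inter> D = {}"
    using BC BD by (auto simp: C_def D_def)
  have fin: "finite C" "finite D" using BC BD by (simp_all add: C_def D_def)
  have BCD: "indep (B \<union> C \<union> D)" "C \<inter> D = {}"
    using indep_Un[OF U W B(4), of C D] BC BD eq fin by auto
  let ?T = "hext (vadd V) U W"
  have T: "linear_subset ?T" by (rule linear_subset_sum[OF U W])
  have "U = span BC" "W = span BD"
    using span_least[OF U, of BC] span_least[OF W, of BD] BC BD by auto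
  \<comment> \<open>By \<open>span_Un\<close>, the sum of the spans of \<open>BC\<close> and
    \<open>BD\<close> is the span of their union.\<close>
  then have span: "?T = span (B \<union> C \<union> D)"
  proof -
    have "B \<union> C \<union> D = BC \<union> BD" using eq by auto
    moreover have "BC \<subseteq> carrier V" "BD \<subseteq> carrier V" using BC BD UV WV by auto
    ultimately show ?thesis
      using span_Un[of BC BD] \<open>U = span BC\<close> \<open>W = span BD\<close> by simp
  qed
  have BCDT: "finite (B \<union> C \<union> D)" "B \<union> C \<union> D \<subseteq> ?T" "?T \<subseteq> span (B \<union> C \<union> D)"
    using B fin span span_superset[of "B \<union> C \<union> D"] by auto
  note dT = basis_dim[OF T BCDT(1,2) BCD(1) BCDT(3)]
  note dI = basis_dim[OF linear_subset_Int[OF U W] B(1,3,2,4)]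
  show "finite_dimensional F (restrict_space V ?T)"
    and "finite_dimensional F (restrict_space V (U \<inter> W))"
    using dT dI by blast+
  \<comment> \<open>\<open>B\<close>, \<open>C\<close> and \<open>D\<close> are pairwise disjoint,
    so cardinalities add and \<open>B\<close> is counted twice in \<open>BC\<close> and
    \<open>BD\<close> together.\<close>
  have "card BC = card B + card C" "card BD = card B + card D"
    "card (B \<union> C \<union> D) = card B + card C + card D"
    using eq BCD(2) B(1) fin by (simp_all add: card_Un_disjoint Int_Un_distrib2)
  then show "hdim F (restrict_space V ?T) + hdim F (restrict_space V (U \<inter> W))
      = hdim F (restrict_space V U) + hdim F (restrict_space V W)"
    using dT(2) dI(2) basis_dim(2)[OF U BC(2,4,3,5)] basis_dim(2)[OF W BD(2,4,3,5)] by simp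
qed

end

theorem theorem6p5:
  fixes F :: "('f, 'm) hyperring_scheme" and V :: "('f, 'v, 'n) hypervec_scheme"
    and U W :: "'v set"
  assumes "hypervector_space F V"
    and "strongly_left_distributive F V"
    and "hypersubspace F V U" and "finite_dimensional F (restrict_space V U)"
    and "hypersubspace F V W" and "finite_dimensional F (restrict_space V W)"
  shows "hypersubspace F V (hext (vadd V) U W)
    \<and> finite_dimensional F (restrict_space V (hext (vadd V) U W))
    \<and> hypersubspace F V (U \<inter> W)
    \<and> finite_dimensional F (restrict_space V (U \<inter> W))
    \<and> int (hdim F (restrict_space V (hext (vadd V) U W)))
      = int (hdim F (restrict_space V U)) + int (hdim F (restrict_space V W))
        - int (hdim F (restrict_space V (U \<inter> W)))"
proof -
  interpret sld_hypervector_space F V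
    using assms(1,2) by (simp add: sld_hypervector_space_def sld_hypervector_space_axioms_def)
  have U: "linear_subset U" and W: "linear_subset W"
    using assms hypersubspace_iff by auto
  show ?thesis
    using hdim_sum[OF U assms(4) W assms(6)] linear_subset_sum[OF U W] linear_subset_Int[OF U W]
    by (simp add: hypersubspace_iff)
qed

end
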